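(* Let $\delta\ge1$, let $\varepsilon\in(0,1)$ and let $T(n)\le 1/(210\varepsilon\delta\log_2 n)$. Let $G\in\mathcal{G}$ be an $n$-vertex graph with $n\ge3$ whose worst-case mixing time satisfies $\tau_G\le T(n)$. Let $k\ge1$, let $r$ be an arbitrary reset vector on $G$, let $X_1,\dots,X_k$ be drawn independently from $V_G$ with distribution $\mathrm{PR}(G,r,\varepsilon)$, and let $K=\{X_1,\dots,X_k\}$. Then with probability at least $1-4^{-k}n$, $\mathbf{D}_\delta(R_{\min}(G,K,\varepsilon),G)\le 1+210\varepsilon\delta T(n)\log_2 n$. (Here $R_{\min}(G,K,\varepsilon)$ is the output of T-Min-PPR$_{k,\varepsilon}$ on $(G,K)$.)
   Context: Graphs are finite directed graphs; every vertex with no out-edges carries a self-loop. The uniform random walk moves to a uniformly random out-neighbour. A ranking (reset) vector is $x:V\to[0,1]$ with $\sum_v x[v]=1$. $\mathrm{PR}(G,r,\varepsilon)$ is the unique stationary distribution of the chain with transition matrix $(1-\varepsilon)M+\varepsilon R$, $M[u,v]=1/d_{out}(u)$ for $(u,v)\in E$ (else 0), $R[u,v]=r[v]$; $\mathrm{PR}(G,c,\varepsilon)$ uses the point mass at $c$. $\mathcal{G}$ is the set of graphs whose uniform random walk is ergodic with stationary distribution $\mathcal{R}(G)$. $\tau_G=\min\{t\ge0:\forall v,\ d_{TV}(p_{t,v},\mathcal{R}(G))\le1/4\}$, $p_{t,v}$ the walk's distribution at time $t$ from $v$, $d_{TV}(p,q)=\frac12\sum|p[v]-q[v]|$. A set $K$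 is coherent if non-empty and some vertex is reachable from every vertex of $K$ (in $G\in\mathcal{G}$ every non-empty set is coherent); $R_{\min}(G,K,\varepsilon)=y/\|y\|_1$ with $y[v]=\min_{c\in K}\mathrm{PR}(G,c,\varepsilon)[v]$. For an $n$-vertex $G\in\mathcal{G}$ and ranking vector $x$: $\mathrm{str}_\delta(x,G,v)=\max\{x[v],n^{-\delta}\}/\max\{\mathcal{R}(G)[v],n^{-\delta}\}$, $\mathrm{cont}_\delta(x,G,v)=\max\{\mathcal{R}(G)[v],n^{-\delta}\}/\max\{x[v],n^{-\delta}\}$, $\mathbf{D}_\delta(x,G,v)=\max\{\mathrm{str}_\delta,\mathrm{cont}_\delta\}$ and $\mathbf{D}_\delta(x,G)=\max_{v\in V}\mathbf{D}_\delta(x,G,v)$. *)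

theory Defs
  imports "HOL-Probability.Probability" "Graph_Theory.Graph_Theory"
begin

text \<open>
  Vectors and matrices indexed by a finite vertex set are functions on the ambient type; only their
  values on that set matter, and probability vectors are required to vanish outside it, so that
  they are determined by their values on it.
\<close>

definition ranking_vector :: "'a set \<Rightarrow> ('a \<Rightarrow> real) \<Rightarrow> bool" where
  "ranking_vector V x \<longleftrightarrow>
     (\<forall>v\<in>V. 0 \<le> x v \<and> x v \<le> 1) \<and> (\<forall>v. v \<notin> V \<longrightarrow> x v = 0) \<and> (\<Sum>v\<in>V. x v) = 1"

definition stationary :: "'a set \<Rightarrow> ('a \<Rightarrow> 'a \<Rightarrow> real) \<Rightarrow> ('a \<Rightarrow> real) \<Rightarrow> bool" where
  "stationary V P \<pi> \<longleftrightarrow> ranking_vector V \<pi> \<and> (\<forall>v\<in>V. (\<Sum>u\<in>V. \<pi> u * P u v) = \<pi> v)"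

definition stationary_distribution :: "'a set \<Rightarrow> ('a \<Rightarrow> 'a \<Rightarrow> real) \<Rightarrow> 'a \<Rightarrow> real" where
  "stationary_distribution V P = (THE \<pi>. stationary V P \<pi>)"

definition tv_dist :: "'a set \<Rightarrow> ('a \<Rightarrow> real) \<Rightarrow> ('a \<Rightarrow> real) \<Rightarrow> real" where
  "tv_dist V p q = (\<Sum>v\<in>V. \<bar>p v - q v\<bar>) / 2"

text \<open>
  Loops are allowed. The convention that a vertex with no out-edges carries a self-loop amounts to
  every vertex having an out-edge.
\<close>

locale sinkless_digraph = pair_fin_digraph G for G :: "'a pair_pre_digraph" +
  assumes sinkless: "v \<in> pverts G \<Longrightarrow> \<exists>w. (v, w) \<in> parcs G"

definition walk_matrix :: "'a pair_pre_digraph \<Rightarrow> 'a \<Rightarrow> 'a \<Rightarrow> real" where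
  "walk_matrix G u v = (if (u, v) \<in> parcs G then 1 / real (out_degree G u) else 0)"

primrec walk_dist :: "'a pair_pre_digraph \<Rightarrow> nat \<Rightarrow> 'a \<Rightarrow> 'a \<Rightarrow> real" where
  "walk_dist G 0 v = indicat_real {v}"
| "walk_dist G (Suc t) v = (\<lambda>w. \<Sum>u\<in>pverts G. walk_dist G t v u * walk_matrix G u w)"

text \<open>
  Ergodicity: from every starting vertex the walk converges to one and the same stationary
  distribution (which is then unique). Transient vertices are allowed, so this covers the
  irreducible aperiodic walks as a special case.
\<close>

definition ergodic_graphs :: "'a pair_pre_digraph set" where
  "ergodic_graphs = {G. sinkless_digraph G \<and>
     (\<exists>\<pi>. stationary (pverts G) (walk_matrix G) \<pi> \<and>
       (\<forall>u\<in>pverts G. \<forall>v\<in>pverts G. (\<lambda>t. walk_dist G t u v) \<longlonglongrightarrow> \<pi> v))}"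

definition reference_rank :: "'a pair_pre_digraph \<Rightarrow> 'a \<Rightarrow> real" where
  "reference_rank G = stationary_distribution (pverts G) (walk_matrix G)"

definition mixing_time :: "'a pair_pre_digraph \<Rightarrow> nat" where
  "mixing_time G =
     (LEAST t. \<forall>v\<in>pverts G. tv_dist (pverts G) (walk_dist G t v) (reference_rank G) \<le> 1 / 4)"

definition pagerank :: "'a pair_pre_digraph \<Rightarrow> ('a \<Rightarrow> real) \<Rightarrow> real \<Rightarrow> 'a \<Rightarrow> real" where
  "pagerank G r \<epsilon> =
     stationary_distribution (pverts G) (\<lambda>u v. (1 - \<epsilon>) * walk_matrix G u v + \<epsilon> * r v)"

definition min_ppr :: "'a pair_pre_digraph \<Rightarrow> 'a set \<Rightarrow> real \<Rightarrow> 'a \<Rightarrow> real" where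
  "min_ppr G K \<epsilon> v = Min ((\<lambda>c. pagerank G (indicat_real {c}) \<epsilon> v) ` K)"

text \<open>
  The normalisation presupposes that \<open>K\<close> is coherent, i.e. nonempty and such that some vertex is
  reachable from all of \<open>K\<close>. In an ergodic graph every nonempty set of vertices is coherent.
\<close>

definition R_min :: "'a pair_pre_digraph \<Rightarrow> 'a set \<Rightarrow> real \<Rightarrow> 'a \<Rightarrow> real" where
  "R_min G K \<epsilon> v = min_ppr G K \<epsilon> v / (\<Sum>w\<in>pverts G. \<bar>min_ppr G K \<epsilon> w\<bar>)"

definition stretch :: "real \<Rightarrow> ('a \<Rightarrow> real) \<Rightarrow> 'a pair_pre_digraph \<Rightarrow> 'a \<Rightarrow> real" where
  "stretch \<delta> x G v =
     max (x v) (real (card (pverts G)) powr - \<delta>) /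
     max (reference_rank G v) (real (card (pverts G)) powr - \<delta>)"

definition contraction :: "real \<Rightarrow> ('a \<Rightarrow> real) \<Rightarrow> 'a pair_pre_digraph \<Rightarrow> 'a \<Rightarrow> real" where
  "contraction \<delta> x G v =
     max (reference_rank G v) (real (card (pverts G)) powr - \<delta>) /
     max (x v) (real (card (pverts G)) powr - \<delta>)"

definition distortion_at :: "real \<Rightarrow> ('a \<Rightarrow> real) \<Rightarrow> 'a pair_pre_digraph \<Rightarrow> 'a \<Rightarrow> real" where
  "distortion_at \<delta> x G v = max (stretch \<delta> x G v) (contraction \<delta> x G v)"

definition distortion :: "real \<Rightarrow> ('a \<Rightarrow> real) \<Rightarrow> 'a pair_pre_digraph \<Rightarrow> real" where
  "distortion \<delta> x G = Max (distortion_at \<delta> x G ` pverts G)"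

end

theory Submission
  imports Defs
begin

text \<open>
  Let \<open>\<tau>\<close> be the mixing time and \<open>L = \<tau> m\<close> with \<open>m\<close> about \<open>\<delta> log\<^sub>2 n\<close>. Unrolling the PageRank
  equation \<open>L\<close> times splits a personalised PageRank vector into an early part of mass
  \<open>a = 1 - (1 - \<epsilon>)\<^sup>L \<le> \<epsilon> L\<close> and a late part, which has walked \<open>L\<close> steps and agrees with the stationary
  distribution \<open>\<pi>\<close> up to a pointwise error \<open>\<eta> \<le> a n\<^bsup>-\<delta>\<^esup>\<close>. The late part alone bounds every
  PageRank from below, which gives the contraction bound. For the stretch bound at \<open>v\<close> it
  suffices that some sampled centre has an early part of order \<open>a \<pi>(v)\<close> at \<open>v\<close>. A sample from
  \<open>PR(G, r, \<epsilon>)\<close> is, up to mass \<open>a\<close>, nearly distributed as \<open>\<pi>\<close>, and the early part started from \<open>\<pi>\<close> has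
  mean at most about \<open>a \<pi>(v)\<close>, so by Markov's inequality a sample fails with probability at most
  \<open>1/4\<close>. All \<open>k\<close> samples fail at \<open>v\<close> with probability at most \<open>4\<^sup>-\<^sup>k\<close>, and a union bound over the
  \<open>n\<close> vertices concludes.
\<close>

section \<open>Finite stochastic matrices acting on row vectors\<close>

locale row_stochastic =
  fixes V :: "'a set" and M :: "'a \<Rightarrow> 'a \<Rightarrow> real"
  assumes finite_V: "finite V"
    and nonneg: "u \<in> V \<Longrightarrow> v \<in> V \<Longrightarrow> 0 \<le> M u v"
    and row_sum: "u \<in> V \<Longrightarrow> (\<Sum>v\<in>V. M u v) = 1"
begin

definition push :: "('a \<Rightarrow> real) \<Rightarrow> 'a \<Rightarrow> real" where
  "push x w = (\<Sum>u\<in>V. x u * M u w)"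

text \<open>\<open>push\<close> is right multiplication by \<open>M\<close>, so iterates of
  \<open>x\<close> mix the walks from single vertices. Congruence on \<open>V\<close>, linearity and
  comparison with the walk all rest on this.\<close>

lemma push_iter_expand:
  "w \<in> V \<Longrightarrow> (push ^^ t) x w = (\<Sum>u\<in>V. x u * (push ^^ t) (indicat_real {u}) w)"
proof (induction t arbitrary: w)
  case 0
  have "(\<Sum>u\<in>V. x u * indicat_real {u} w) = (\<Sum>u\<in>V. if w = u then x u else 0)"
    by (intro sum.cong) (auto simp: indicator_def)
  with 0 show ?case by (simp add: finite_V)
next
  case (Suc t)
  have "(push ^^ Suc t) x w
      = (\<Sum>z\<in>V. (\<Sum>u\<in>V. x u * (push ^^ t) (indicat_real {u}) z) * M z w)"
    by (simp add: push_def[of "(push ^^ t) x"] Suc.IH)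
  also have "\<dots> = (\<Sum>z\<in>V. \<Sum>u\<in>V. x u * ((push ^^ t) (indicat_real {u}) z * M z w))"
    by (simp add: sum_distrib_right mult.assoc)
  also have "\<dots> = (\<Sum>u\<in>V. \<Sum>z\<in>V. x u * ((push ^^ t) (indicat_real {u}) z * M z w))"
    by (rule sum.swap)
  also have "\<dots> = (\<Sum>u\<in>V. x u * (push ^^ Suc t) (indicat_real {u}) w)"
    by (simp add: push_def sum_distrib_left)
  finally show ?case .
qed

lemma push_iter_cong:
  assumes "\<And>u. u \<in> V \<Longrightarrow> x u = y u" and "w \<in> V"
  shows "(push ^^ t) x w = (push ^^ t) y w"
  using assms by (simp add: push_iter_expand[of w t x] push_iter_expand[of w t y])

lemma push_iter_linear:
  assumes "w \<in> V"
  shows "(push ^^ t) (\<lambda>u. a * x u + b * y u) w = a * (push ^^ t) x w + b * (push ^^ t) y w"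
  unfolding push_iter_expand[OF assms, of t x] push_iter_expand[OF assms, of t y]
    push_iter_expand[OF assms, of t "\<lambda>u. a * x u + b * y u"]
  by (simp add: sum_distrib_left sum.distrib algebra_simps)

lemma sum_push: "(\<Sum>w\<in>V. push x w) = (\<Sum>w\<in>V. x w)"
proof -
  have "(\<Sum>w\<in>V. push x w) = (\<Sum>u\<in>V. x u * (\<Sum>w\<in>V. M u w))"
    unfolding push_def by (subst sum.swap) (simp add: sum_distrib_left)
  then show ?thesis by (simp add: row_sum)
qed

lemma sum_push_iter: "(\<Sum>w\<in>V. (push ^^ t) x w) = (\<Sum>w\<in>V. x w)"
  by (induction t) (simp_all add: sum_push)

lemma push_iter_nonneg:
  assumes "\<And>u. u \<in> V \<Longrightarrow> 0 \<le> x u"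
  shows "w \<in> V \<Longrightarrow> 0 \<le> (push ^^ t) x w"
  using assms
  by (induction t arbitrary: w) (auto simp: push_def intro!: sum_nonneg mult_nonneg_nonneg nonneg)

text \<open>Triangle inequality, then preservation of mass for the absolute values. It is applied to
  differences of distributions, hence the signed \<open>x\<close>.\<close>

lemma push_l1_le: "(\<Sum>w\<in>V. \<bar>push x w\<bar>) \<le> (\<Sum>w\<in>V. \<bar>x w\<bar>)"
proof -
  have "(\<Sum>w\<in>V. \<bar>push x w\<bar>) \<le> (\<Sum>w\<in>V. push (\<lambda>u. \<bar>x u\<bar>) w)"
    unfolding push_def
    by (intro sum_mono order_trans[OF sum_abs]) (auto simp: abs_mult nonneg intro!: sum_mono)
  then show ?thesis by (simp add: sum_push)
qed

lemma push_iter_l1_le: "(\<Sum>w\<in>V. \<bar>(push ^^ t) x w\<bar>) \<le> (\<Sum>w\<in>V. \<bar>x w\<bar>)"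
proof (induction t)
  case (Suc t)
  then show ?case using push_l1_le[of "(push ^^ t) x"] by simp
qed simp

lemma ranking_vector_push_iter_le_1:
  assumes "ranking_vector V x" "w \<in> V"
  shows "(push ^^ t) x w \<le> 1"
proof -
  have "\<And>u. u \<in> V \<Longrightarrow> 0 \<le> (push ^^ t) x u"
    using assms(1) by (intro push_iter_nonneg) (auto simp: ranking_vector_def)
  then have "(push ^^ t) x w \<le> (\<Sum>u\<in>V. (push ^^ t) x u)"
    by (intro member_le_sum assms finite_V) auto
  also have "\<dots> = 1" using assms(1) by (simp add: sum_push_iter ranking_vector_def)
  finally show ?thesis .
qed

lemma stationary_push_iter:
  assumes "stationary V M p" "w \<in> V"
  shows "(push ^^ t) p w = p w"
  using assms(2)
proof (induction t arbitrary: w)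
  case (Suc t)
  then have "(push ^^ Suc t) p w = push p w"
    by (simp add: push_def[of "(push ^^ t) p"] push_def[of p])
  also have "\<dots> = p w" using assms(1) Suc.prems by (simp add: stationary_def push_def)
  finally show ?case .
qed simp

text \<open>A stationary \<open>q\<close> is fixed by every iterate, yet as a mixture of point
  masses its iterates tend to \<open>p\<close>. Both vanish outside \<open>V\<close>, so they agree
  as functions.\<close>

lemma stationary_distribution_eq_limit:
  assumes p: "stationary V M p"
    and lim: "\<And>u v. u \<in> V \<Longrightarrow> v \<in> V \<Longrightarrow> (\<lambda>t. (push ^^ t) (indicat_real {u}) v) \<longlonglongrightarrow> p v"
  shows "stationary_distribution V M = p"
  unfolding stationary_distribution_def
proof (rule the_equality)
  fix q assume q: "stationary V M q"
  show "q = p"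
  proof
    fix v show "q v = p v"
    proof (cases "v \<in> V")
      case True
      have "(\<lambda>t. \<Sum>u\<in>V. q u * (push ^^ t) (indicat_real {u}) v) \<longlonglongrightarrow> (\<Sum>u\<in>V. q u * p v)"
        by (intro tendsto_intros lim True)
      moreover have "(\<Sum>u\<in>V. q u * (push ^^ t) (indicat_real {u}) v) = q v" for t
        using stationary_push_iter[OF q True, of t] push_iter_expand[OF True, of t q] by linarith
      moreover have "(\<Sum>u\<in>V. q u * p v) = p v"
        using q by (simp add: stationary_def ranking_vector_def flip: sum_distrib_right)
      ultimately show ?thesis by (simp add: LIMSEQ_const_iff)
    next
      case False
      then show ?thesis using p q by (simp add: stationary_def ranking_vector_def)
    qed
  qed
qed (rule p)

end

section \<open>PageRank as the fixed point of a chain with restarts\<close>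

lemma geometric_weights_sum:
  fixes \<epsilon> :: real
  shows "(\<Sum>t<L. \<epsilon> * (1 - \<epsilon>) ^ t) = 1 - (1 - \<epsilon>) ^ L"
  by (induction L) (simp_all add: algebra_simps)

locale restart_chain = row_stochastic +
  fixes \<epsilon> :: real
  assumes eps_pos: "0 < \<epsilon>" and eps_less_1: "\<epsilon> < 1"
begin

abbreviation restart :: "('a \<Rightarrow> real) \<Rightarrow> 'a \<Rightarrow> 'a \<Rightarrow> real" where
  "restart r \<equiv> \<lambda>u v. (1 - \<epsilon>) * M u v + \<epsilon> * r v"

definition ppr :: "('a \<Rightarrow> real) \<Rightarrow> 'a \<Rightarrow> real" where
  "ppr r = stationary_distribution V (restart r)"

text \<open>Total mass 1 reduces the rank-one restart term to \<open>\<epsilon> * r v\<close>, which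
  leaves an affine fixed-point equation.\<close>

lemma stationary_restart_iff:
  "stationary V (restart r) p \<longleftrightarrow>
     ranking_vector V p \<and> (\<forall>v\<in>V. p v = \<epsilon> * r v + (1 - \<epsilon>) * push p v)"
proof -
  have "(\<Sum>u\<in>V. p u * restart r u v) = \<epsilon> * r v + (1 - \<epsilon>) * push p v" if "ranking_vector V p" for v
  proof -
    have "(\<Sum>u\<in>V. p u * restart r u v) = (1 - \<epsilon>) * push p v + (\<Sum>u\<in>V. p u) * (\<epsilon> * r v)"
      unfolding push_def distrib_left sum.distrib sum_distrib_left sum_distrib_right
      by (simp add: mult_ac)
    with that show ?thesis by (simp add: ranking_vector_def)
  qed
  then show ?thesis by (simp add: stationary_def eq_commute[of "p _"] cong: conj_cong)
qed

text \<open>The difference of two solutions is 1 - \<epsilon> times its own push, and pushing does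
  not increase the l1 norm, so that norm is zero.\<close>

lemma stationary_restart_unique:
  assumes p: "stationary V (restart r) p" and q: "stationary V (restart r) q"
  shows "p = q"
proof -
  let ?d = "\<lambda>v. p v - q v"
  have "(\<Sum>v\<in>V. \<bar>?d v\<bar>) = (\<Sum>v\<in>V. (1 - \<epsilon>) * \<bar>push ?d v\<bar>)"
  proof (intro sum.cong refl)
    fix v assume "v \<in> V"
    then have "p v = \<epsilon> * r v + (1 - \<epsilon>) * push p v" "q v = \<epsilon> * r v + (1 - \<epsilon>) * push q v"
      using p q unfolding stationary_restart_iff by blast+
    moreover have "(1 - \<epsilon>) * push ?d v = (1 - \<epsilon>) * push p v - (1 - \<epsilon>) * push q v"
      by (simp add: push_def left_diff_distrib sum_subtractf right_diff_distrib)
    ultimately have "?d v = (1 - \<epsilon>) * push ?d v" by linarith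
    then show "\<bar>?d v\<bar> = (1 - \<epsilon>) * \<bar>push ?d v\<bar>"
      using eps_less_1 by (metis abs_mult abs_of_pos diff_gt_0_iff_gt)
  qed
  also have "\<dots> \<le> (1 - \<epsilon>) * (\<Sum>v\<in>V. \<bar>?d v\<bar>)"
    using eps_less_1 by (simp add: push_l1_le flip: sum_distrib_left)
  finally have "\<epsilon> * (\<Sum>v\<in>V. \<bar>?d v\<bar>) \<le> 0" by (simp add: algebra_simps)
  then have "(\<Sum>v\<in>V. \<bar>?d v\<bar>) = 0"
    using eps_pos by (intro antisym sum_nonneg) (auto simp: mult_le_0_iff)
  then have "p v = q v" if "v \<in> V" for v
    using that finite_V by (simp add: sum_nonneg_eq_0_iff)
  moreover have "p v = q v" if "v \<notin> V" for v
    using that p q by (simp add: stationary_def ranking_vector_def)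
  ultimately show ?thesis by blast
qed

text \<open>Neumann series of the fixed-point equation: \<open>p\<close> is the law of the walk from
  \<open>r\<close> stopped at an independent geometric time.\<close>

lemma stationary_restart_exists:
  assumes r: "ranking_vector V r"
  shows "\<exists>p. stationary V (restart r) p"
proof -
  let ?f = "\<lambda>v t. \<epsilon> * (1 - \<epsilon>) ^ t * (push ^^ t) r v"
  define p where "p v = (if v \<in> V then \<Sum>t. ?f v t else 0)" for v
  have nn: "0 \<le> (push ^^ t) r v" if "v \<in> V" for v t
    using r that by (intro push_iter_nonneg) (auto simp: ranking_vector_def)
  have geo: "summable (\<lambda>t. \<epsilon> * (1 - \<epsilon>) ^ t)"
    using eps_pos eps_less_1 by (intro summable_mult summable_geometric) auto
  have summ: "summable (?f v)" if "v \<in> V" for v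
    using nn[OF that] ranking_vector_push_iter_le_1[OF r that] eps_pos eps_less_1
    by (intro summable_comparison_test[OF _ geo]) (auto intro!: exI mult_left_le simp: abs_mult)
  have nonneg_p: "0 \<le> p v" for v
    using nn summ eps_pos eps_less_1 by (auto simp: p_def intro!: suminf_nonneg)
  have "(\<Sum>v\<in>V. p v) = (\<Sum>t. \<Sum>v\<in>V. ?f v t)"
    using summ by (simp add: p_def suminf_sum)
  also have "\<dots> = (\<Sum>t. \<epsilon> * (1 - \<epsilon>) ^ t)"
    using r by (simp add: sum_push_iter ranking_vector_def flip: sum_distrib_left)
  also have "\<dots> = 1"
    using eps_pos eps_less_1 by (subst suminf_mult) (auto simp: suminf_geometric)
  finally have sum_p: "(\<Sum>v\<in>V. p v) = 1" .
  have "p v \<le> 1" if "v \<in> V" for v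
    using member_le_sum[OF that, of p] nonneg_p finite_V sum_p by simp
  moreover have "p v = 0" if "v \<notin> V" for v
    using that by (simp add: p_def)
  ultimately have "ranking_vector V p"
    using nonneg_p sum_p by (simp add: ranking_vector_def)
  moreover have "p v = \<epsilon> * r v + (1 - \<epsilon>) * push p v" if v: "v \<in> V" for v
  proof -
    have "p v = \<epsilon> * r v + (\<Sum>t. ?f v (Suc t))"
      using v suminf_split_head[OF summ[OF v]] by (simp add: p_def)
    also have "(\<lambda>t. ?f v (Suc t)) = (\<lambda>t. \<Sum>u\<in>V. (1 - \<epsilon>) * M u v * ?f u t)"
      by (simp add: push_def sum_distrib_left mult_ac)
    also have "(\<Sum>t. \<Sum>u\<in>V. (1 - \<epsilon>) * M u v * ?f u t) = (\<Sum>u\<in>V. \<Sum>t. (1 - \<epsilon>) * M u v * ?f u t)"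
      by (intro suminf_sum summable_mult summ)
    also have "\<dots> = (\<Sum>u\<in>V. (1 - \<epsilon>) * M u v * (\<Sum>t. ?f u t))"
      by (intro sum.cong refl suminf_mult summ)
    also have "\<dots> = (1 - \<epsilon>) * push p v"
      by (simp add: p_def push_def sum_distrib_left mult_ac)
    finally show ?thesis .
  qed
  ultimately show ?thesis unfolding stationary_restart_iff by blast
qed

lemma stationary_ppr:
  assumes "ranking_vector V r"
  shows "stationary V (restart r) (ppr r)"
  unfolding ppr_def stationary_distribution_def
  by (rule theI'[where P = "stationary V (restart r)"])
    (use stationary_restart_exists[OF assms] stationary_restart_unique in blast)

lemma ranking_vector_ppr:
  assumes "ranking_vector V r"
  shows "ranking_vector V (ppr r)"
  using stationary_ppr[OF assms] by (simp add: stationary_def)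

text \<open>Condition on the last restart: either it happened t < L steps ago and the walk has since
  made t steps from \<open>r\<close>, or the last L steps, begun at \<open>ppr r\<close>, had
  none.\<close>

lemma ppr_unroll:
  assumes r: "ranking_vector V r" and v: "v \<in> V"
  shows "ppr r v = (\<Sum>t<L. \<epsilon> * (1 - \<epsilon>) ^ t * (push ^^ t) r v) + (1 - \<epsilon>) ^ L * (push ^^ L) (ppr r) v"
proof (induction L)
  case (Suc L)
  have "(push ^^ L) (ppr r) v = (push ^^ L) (\<lambda>u. \<epsilon> * r u + (1 - \<epsilon>) * push (ppr r) u) v"
    using stationary_ppr[OF r] v unfolding stationary_restart_iff by (intro push_iter_cong) auto
  also have "\<dots> = \<epsilon> * (push ^^ L) r v + (1 - \<epsilon>) * (push ^^ Suc L) (ppr r) v"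
    by (simp add: push_iter_linear[OF v] funpow_swap1)
  finally have step: "(push ^^ L) (ppr r) v
      = \<epsilon> * (push ^^ L) r v + (1 - \<epsilon>) * (push ^^ Suc L) (ppr r) v" .
  show ?case by (subst Suc) (simp add: step algebra_simps)
qed simp

end

section \<open>Distance of PageRank from the stationary distribution of a mixing chain\<close>

text \<open>
  The bound \<open>1/2\<close> on the \<open>l\<^sub>1\<close> distance is the bound \<open>1/4\<close> on the total variation distance.
\<close>

locale mixing_restart_chain = restart_chain +
  fixes \<pi> :: "'a \<Rightarrow> real" and \<tau> m :: nat
  assumes stationary_pi: "stationary V M \<pi>"
    and mixing: "u \<in> V \<Longrightarrow> (\<Sum>v\<in>V. \<bar>(push ^^ \<tau>) (indicat_real {u}) v - \<pi> v\<bar>) \<le> 1 / 2"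
    and tau_pos: "0 < \<tau>" and m_pos: "0 < m"
begin

abbreviation L :: nat where "L \<equiv> \<tau> * m"

text \<open>The probability that a restart happens within the first \<open>L\<close> steps.\<close>

definition a :: real where "a = 1 - (1 - \<epsilon>) ^ L"

text \<open>Every PageRank is within 4a of \<pi> in l1 norm (\<open>ppr_l1_deviation\<close>), and
  each of the m rounds of \<tau> steps halves this.\<close>

definition \<eta> :: real where "\<eta> = 4 * a * (1 / 2) ^ m"

lemma a_pos: "0 < a"
  using eps_pos eps_less_1 tau_pos m_pos by (simp add: a_def power_less_one_iff)

lemma a_le: "a \<le> \<epsilon> * real L"
  using Bernoulli_inequality[of "- \<epsilon>" L] eps_less_1 by (simp add: a_def mult_ac)

lemma eta_pos: "0 < \<eta>"
  using a_pos by (simp add: \<eta>_def)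

lemma ranking_pi: "ranking_vector V \<pi>"
  using stationary_pi by (simp add: stationary_def)

lemma pi_nonneg: "v \<in> V \<Longrightarrow> 0 \<le> \<pi> v"
  using ranking_pi by (simp add: ranking_vector_def)

text \<open>As \<open>z\<close> has total mass zero, subtracting \<pi> from each row of the
  \<tau>-step matrix changes nothing, and the corrected rows have l1 norm at most 1/2.\<close>

lemma push_tau_contracts:
  assumes "(\<Sum>v\<in>V. z v) = 0"
  shows "(\<Sum>v\<in>V. \<bar>(push ^^ \<tau>) z v\<bar>) \<le> (\<Sum>v\<in>V. \<bar>z v\<bar>) / 2"
proof -
  let ?p = "\<lambda>u. (push ^^ \<tau>) (indicat_real {u})"
  have "(\<Sum>v\<in>V. \<bar>(push ^^ \<tau>) z v\<bar>) = (\<Sum>v\<in>V. \<bar>\<Sum>u\<in>V. z u * (?p u v - \<pi> v)\<bar>)"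
    using assms by (intro sum.cong refl)
      (simp add: push_iter_expand[of _ \<tau> z] right_diff_distrib sum_subtractf flip: sum_distrib_right)
  also have "\<dots> \<le> (\<Sum>v\<in>V. \<Sum>u\<in>V. \<bar>z u\<bar> * \<bar>?p u v - \<pi> v\<bar>)"
    by (intro sum_mono order_trans[OF sum_abs]) (simp add: abs_mult)
  also have "\<dots> = (\<Sum>u\<in>V. \<bar>z u\<bar> * (\<Sum>v\<in>V. \<bar>?p u v - \<pi> v\<bar>))"
    by (subst sum.swap) (simp add: sum_distrib_left)
  also have "\<dots> \<le> (\<Sum>u\<in>V. \<bar>z u\<bar> * (1 / 2))"
    by (intro sum_mono mult_left_mono mixing) auto
  finally show ?thesis by (simp add: sum_divide_distrib)
qed

lemma push_tau_iter_contracts: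
  assumes "(\<Sum>v\<in>V. z v) = 0"
  shows "(\<Sum>v\<in>V. \<bar>(push ^^ (\<tau> * j)) z v\<bar>) \<le> (1 / 2) ^ j * (\<Sum>v\<in>V. \<bar>z v\<bar>)"
proof (induction j)
  case (Suc j)
  have "(\<Sum>v\<in>V. \<bar>(push ^^ (\<tau> * Suc j)) z v\<bar>) = (\<Sum>v\<in>V. \<bar>(push ^^ \<tau>) ((push ^^ (\<tau> * j)) z) v\<bar>)"
    by (simp add: funpow_add)
  also have "\<dots> \<le> (\<Sum>v\<in>V. \<bar>(push ^^ (\<tau> * j)) z v\<bar>) / 2"
    by (intro push_tau_contracts) (simp add: sum_push_iter assms)
  also have "\<dots> \<le> (1 / 2) ^ Suc j * (\<Sum>v\<in>V. \<bar>z v\<bar>)" using Suc by simp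
  finally show ?case .
qed simp

lemma push_iter_diff_pi:
  assumes "v \<in> V"
  shows "(push ^^ t) (\<lambda>u. x u - \<pi> u) v = (push ^^ t) x v - \<pi> v"
  using push_iter_linear[OF assms, of t 1 x "-1" \<pi>] stationary_push_iter[OF stationary_pi assms]
  by simp

lemma sum_diff_pi:
  assumes "ranking_vector V x"
  shows "(\<Sum>v\<in>V. x v - \<pi> v) = 0"
  using assms ranking_pi by (simp add: sum_subtractf ranking_vector_def)

text \<open>
  The first \<open>L\<close> steps carry weight \<open>a\<close>, and the remainder is itself a contraction of the
  deviation being bounded. Hence the bound is proportional to \<open>a\<close>, however small \<open>\<epsilon>\<close> is.
\<close>

lemma ppr_l1_deviation:
  assumes r: "ranking_vector V r"
  shows "(\<Sum>v\<in>V. \<bar>ppr r v - \<pi> v\<bar>) \<le> 4 * a"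
proof -
  let ?D = "\<Sum>v\<in>V. \<bar>ppr r v - \<pi> v\<bar>"
  let ?w = "\<lambda>t. \<epsilon> * (1 - \<epsilon>) ^ t"
  note pos = eps_pos eps_less_1
  have "\<bar>ppr r v - \<pi> v\<bar> \<le> (\<Sum>t<L. ?w t * ((push ^^ t) r v + \<pi> v))
      + \<bar>(push ^^ L) (\<lambda>u. ppr r u - \<pi> u) v\<bar>" if v: "v \<in> V" for v
  proof -
    \<comment> \<open>The walk fixes \<pi>, so \<pi> splits with the weights of the unrolled
      PageRank and can be subtracted term by term.\<close>
    have "\<pi> v = (\<Sum>t<L. ?w t * \<pi> v) + (1 - \<epsilon>) ^ L * \<pi> v"
      unfolding sum_distrib_right[symmetric] geometric_weights_sum by (simp add: algebra_simps)
    then have "ppr r v - \<pi> v = (\<Sum>t<L. ?w t * ((push ^^ t) r v - \<pi> v))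
        + (1 - \<epsilon>) ^ L * (push ^^ L) (\<lambda>u. ppr r u - \<pi> u) v"
      using ppr_unroll[OF r v, of L]
      by (simp add: push_iter_diff_pi v right_diff_distrib sum_subtractf)
    moreover have "\<bar>\<Sum>t<L. ?w t * ((push ^^ t) r v - \<pi> v)\<bar> \<le> (\<Sum>t<L. ?w t * ((push ^^ t) r v + \<pi> v))"
    proof (intro order_trans[OF sum_abs] sum_mono)
      fix t
      have "0 \<le> (push ^^ t) r v" using r v by (intro push_iter_nonneg) (auto simp: ranking_vector_def)
      then show "\<bar>?w t * ((push ^^ t) r v - \<pi> v)\<bar> \<le> ?w t * ((push ^^ t) r v + \<pi> v)"
        using pos pi_nonneg[OF v] by (simp add: abs_mult)
    qed
    moreover have "\<bar>(1 - \<epsilon>) ^ L * (push ^^ L) (\<lambda>u. ppr r u - \<pi> u) v\<bar>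
        \<le> \<bar>(push ^^ L) (\<lambda>u. ppr r u - \<pi> u) v\<bar>"
      using pos by (simp add: abs_mult mult_left_le_one_le power_le_one)
    ultimately show ?thesis by linarith
  qed
  then have "?D \<le> (\<Sum>v\<in>V. (\<Sum>t<L. ?w t * ((push ^^ t) r v + \<pi> v))
      + \<bar>(push ^^ L) (\<lambda>u. ppr r u - \<pi> u) v\<bar>)" by (rule sum_mono)
  also have "\<dots> = (\<Sum>t<L. ?w t * (\<Sum>v\<in>V. (push ^^ t) r v + \<pi> v))
      + (\<Sum>v\<in>V. \<bar>(push ^^ L) (\<lambda>u. ppr r u - \<pi> u) v\<bar>)"
    by (subst sum.distrib, subst sum.swap) (simp only: sum_distrib_left)
  also have "(\<Sum>t<L. ?w t * (\<Sum>v\<in>V. (push ^^ t) r v + \<pi> v)) = 2 * a"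
    using r ranking_pi
    by (simp add: sum.distrib sum_push_iter ranking_vector_def geometric_weights_sum a_def
        flip: sum_distrib_right)
  also have "(\<Sum>v\<in>V. \<bar>(push ^^ L) (\<lambda>u. ppr r u - \<pi> u) v\<bar>) \<le> (1 / 2) ^ m * ?D"
    by (intro push_tau_iter_contracts sum_diff_pi ranking_vector_ppr r)
  \<comment> \<open>With m \<ge> 1 the deviation D satisfies D \<le> 2a + D/2, which gives
    4a.\<close>
  also have "(1 / 2) ^ m * ?D \<le> 1 / 2 * ?D"
    using m_pos power_decreasing[of 1 m "1 / 2 :: real"] by (intro mult_right_mono sum_nonneg) auto
  finally show ?thesis by simp
qed

text \<open>The l1 norm dominates each coordinate and further steps do not increase it. Uniformity
  in t serves \<open>bad_centers_mass\<close>, where an early walk starts from a late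
  sample.\<close>

lemma push_iter_ppr_deviation:
  assumes r: "ranking_vector V r" and v: "v \<in> V"
  shows "\<bar>(push ^^ (t + L)) (ppr r) v - \<pi> v\<bar> \<le> \<eta>"
proof -
  let ?z = "\<lambda>u. ppr r u - \<pi> u"
  have "\<bar>(push ^^ (t + L)) (ppr r) v - \<pi> v\<bar> = \<bar>(push ^^ t) ((push ^^ L) ?z) v\<bar>"
    using push_iter_diff_pi[OF v, of "t + L"] by (simp add: funpow_add)
  also have "\<dots> \<le> (\<Sum>u\<in>V. \<bar>(push ^^ t) ((push ^^ L) ?z) u\<bar>)"
    by (intro member_le_sum[OF v, of "\<lambda>u. \<bar>(push ^^ t) ((push ^^ L) ?z) u\<bar>"] finite_V) auto
  also have "\<dots> \<le> (\<Sum>u\<in>V. \<bar>(push ^^ L) ?z u\<bar>)" by (rule push_iter_l1_le)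
  also have "\<dots> \<le> (1 / 2) ^ m * (\<Sum>u\<in>V. \<bar>?z u\<bar>)"
    by (intro push_tau_iter_contracts sum_diff_pi ranking_vector_ppr r)
  also have "\<dots> \<le> (1 / 2) ^ m * (4 * a)"
    by (intro mult_left_mono ppr_l1_deviation r) auto
  finally show ?thesis by (simp add: \<eta>_def mult_ac)
qed

lemma ppr_lower_bound:
  assumes r: "ranking_vector V r" and v: "v \<in> V"
  shows "(1 - a) * (\<pi> v - \<eta>) \<le> ppr r v"
proof -
  have "0 \<le> (\<Sum>t<L. \<epsilon> * (1 - \<epsilon>) ^ t * (push ^^ t) r v)"
    using r v eps_pos eps_less_1
    by (auto intro!: sum_nonneg mult_nonneg_nonneg push_iter_nonneg simp: ranking_vector_def)
  moreover have "(1 - \<epsilon>) ^ L * (\<pi> v - \<eta>) \<le> (1 - \<epsilon>) ^ L * (push ^^ L) (ppr r) v"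
    using push_iter_ppr_deviation[OF r v, of 0] eps_less_1 by (intro mult_left_mono) auto
  ultimately show ?thesis using ppr_unroll[OF r v, of L] by (simp add: a_def)
qed

section \<open>Bad centres and their probability\<close>

definition early :: "'a \<Rightarrow> 'a \<Rightarrow> real" where
  "early c v = (\<Sum>t<L. \<epsilon> * (1 - \<epsilon>) ^ t * (push ^^ t) (indicat_real {c}) v)"

text \<open>The mean of \<open>early\<close> at an almost stationary start is at most
  \<open>a * (\<pi> v + \<eta>)\<close>. Five times that mean costs probability 1/5 by Markov,
  leaving 1/20 for samples that are not yet mixed.\<close>

definition bad_centers :: "'a \<Rightarrow> 'a set" where
  "bad_centers v = {c \<in> V. 5 * a * (\<pi> v + \<eta>) < early c v}"

lemma ranking_indicator: "c \<in> V \<Longrightarrow> ranking_vector V (indicat_real {c})"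
  using finite_V by (auto simp: ranking_vector_def indicator_def)

lemma early_nonneg: "c \<in> V \<Longrightarrow> v \<in> V \<Longrightarrow> 0 \<le> early c v"
  unfolding early_def using eps_pos eps_less_1
  by (intro sum_nonneg mult_nonneg_nonneg push_iter_nonneg) auto

lemma ppr_upper_bound:
  assumes c: "c \<in> V" "c \<notin> bad_centers v" and v: "v \<in> V"
  shows "ppr (indicat_real {c}) v \<le> (1 + 5 * a) * (\<pi> v + \<eta>)"
proof -
  let ?x = "(push ^^ L) (ppr (indicat_real {c})) v"
  have "?x \<le> \<pi> v + \<eta>"
    using push_iter_ppr_deviation[OF ranking_indicator[OF c(1)] v, of 0] by simp
  then have "(1 - \<epsilon>) ^ L * ?x \<le> (1 - \<epsilon>) ^ L * (\<pi> v + \<eta>)"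
    using eps_less_1 by (intro mult_left_mono) auto
  also have "\<dots> \<le> \<pi> v + \<eta>"
    using eps_pos eps_less_1 pi_nonneg[OF v] eta_pos
    by (intro mult_left_le_one_le power_le_one) auto
  finally show ?thesis
    using ppr_unroll[OF ranking_indicator[OF c(1)] v, of L] c
    by (simp add: bad_centers_def early_def algebra_simps)
qed

text \<open>
  Up to weight \<open>a\<close>, a sample from \<open>ppr r\<close> has already walked \<open>L\<close> steps and is almost
  stationary, and Markov's inequality applies to \<open>early\<close> at a stationary starting point.
\<close>

lemma bad_centers_mass:
  assumes r: "ranking_vector V r" and v: "v \<in> V" and a: "a \<le> 1 / 20"
  shows "(\<Sum>c\<in>bad_centers v. ppr r c) \<le> 1 / 4"
proof -
  let ?B = "bad_centers v"
  let ?w = "\<lambda>t. \<epsilon> * (1 - \<epsilon>) ^ t"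
  let ?q = "(push ^^ L) (ppr r)"
  let ?s = "\<pi> v + \<eta>"
  have BV: "?B \<subseteq> V" by (auto simp: bad_centers_def)
  have s: "0 < ?s" using pi_nonneg[OF v] eta_pos by simp
  have w: "0 \<le> ?w t" for t using eps_pos eps_less_1 by simp
  have r_nn: "0 \<le> (push ^^ t) r c" if "c \<in> V" for c t
    using r that by (intro push_iter_nonneg) (auto simp: ranking_vector_def)
  have q_nn: "0 \<le> ?q c" if "c \<in> V" for c
    using ranking_vector_ppr[OF r] that by (intro push_iter_nonneg) (auto simp: ranking_vector_def)
  \<comment> \<open>Samples whose last restart is fewer than L steps old are simply given up; their
    total mass is a.\<close>
  have "(\<Sum>c\<in>?B. \<Sum>t<L. ?w t * (push ^^ t) r c) = (\<Sum>t<L. ?w t * (\<Sum>c\<in>?B. (push ^^ t) r c))"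
    by (subst sum.swap) (simp add: sum_distrib_left)
  also have "\<dots> \<le> (\<Sum>t<L. ?w t * (\<Sum>c\<in>V. (push ^^ t) r c))"
    using BV w finite_V r_nn by (intro sum_mono mult_left_mono sum_mono2) auto
  also have "\<dots> = a"
    using r by (simp add: sum_push_iter ranking_vector_def geometric_weights_sum a_def)
  finally have early_mass: "(\<Sum>c\<in>?B. \<Sum>t<L. ?w t * (push ^^ t) r c) \<le> a" .
  \<comment> \<open>Markov's inequality for \<open>early\<close> under \<open>?q\<close>. The mean
    is computed by composing the L steps behind \<open>?q\<close> with the t steps of the early
    walk.\<close>
  have "5 * a * ?s * (\<Sum>c\<in>?B. ?q c) \<le> (\<Sum>c\<in>?B. ?q c * early c v)"
    unfolding sum_distrib_left
  proof (rule sum_mono)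
    fix c assume "c \<in> ?B"
    then show "5 * a * ?s * ?q c \<le> ?q c * early c v"
      using mult_left_mono[of "5 * a * ?s" "early c v" "?q c"] q_nn
      by (simp add: bad_centers_def mult.commute)
  qed
  also have "\<dots> \<le> (\<Sum>c\<in>V. ?q c * early c v)"
    using BV finite_V q_nn early_nonneg v by (intro sum_mono2) auto
  also have "\<dots> = (\<Sum>t<L. ?w t * (\<Sum>c\<in>V. ?q c * (push ^^ t) (indicat_real {c}) v))"
    unfolding early_def sum_distrib_left by (subst sum.swap) (simp add: mult_ac)
  also have "\<dots> = (\<Sum>t<L. ?w t * (push ^^ (t + L)) (ppr r) v)"
    by (simp add: funpow_add push_iter_expand[OF v, of _ ?q])
  also have "\<dots> \<le> (\<Sum>t<L. ?w t * ?s)"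
    using push_iter_ppr_deviation[OF r v] w
    by (intro sum_mono mult_left_mono) (auto simp: abs_le_iff algebra_simps)
  also have "\<dots> = a * ?s"
    by (simp add: geometric_weights_sum a_def flip: sum_distrib_right)
  finally have "a * ?s * (5 * (\<Sum>c\<in>?B. ?q c)) \<le> a * ?s * 1" by (simp add: algebra_simps)
  then have late_mass: "(\<Sum>c\<in>?B. ?q c) \<le> 1 / 5"
    using a_pos s by (simp only: mult_le_cancel_left_pos mult_pos_pos)
  have "(\<Sum>c\<in>?B. ppr r c)
      = (\<Sum>c\<in>?B. \<Sum>t<L. ?w t * (push ^^ t) r c) + (1 - \<epsilon>) ^ L * (\<Sum>c\<in>?B. ?q c)"
    unfolding sum_distrib_left sum.distrib[symmetric]
    using BV by (intro sum.cong refl ppr_unroll r) auto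
  moreover have "(1 - \<epsilon>) ^ L * (\<Sum>c\<in>?B. ?q c) \<le> (\<Sum>c\<in>?B. ?q c)"
    using eps_pos eps_less_1 BV q_nn by (intro mult_left_le_one_le power_le_one sum_nonneg) auto
  \<comment> \<open>1/20 + 1/5 = 1/4.\<close>
  ultimately show ?thesis using early_mass late_mass a by linarith
qed


section \<open>Distortion of the normalised minimum\<close>

text \<open>One good centre per vertex bounds the minimum from above, while the lower bound holds
  for all centres. Later \<open>h\<close> is the floor \<open>n powr - \<delta>\<close>; since
  \<eta> \<le> a h, the additive error is relatively small for values cut off at
  \<open>h\<close>.\<close>

lemma min_ppr_distortion:
  assumes K: "finite K" "K \<noteq> {}" "K \<subseteq> V"
    and good: "\<And>v. v \<in> V \<Longrightarrow> \<not> K \<subseteq> bad_centers v"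
    and h: "0 < h" "real (card V) * h \<le> 1"
    and eta: "\<eta> \<le> a * h" and a: "a \<le> 1 / 50"
    and y: "\<And>v. y v = Min ((\<lambda>c. ppr (indicat_real {c}) v) ` K)"
    and x: "\<And>v. x v = y v / (\<Sum>w\<in>V. \<bar>y w\<bar>)"
    and v: "v \<in> V"
  shows "max (x v) h / max (\<pi> v) h \<le> 1 + 50 * a" (is ?stretch)
    and "max (\<pi> v) h / max (x v) h \<le> 1 + 50 * a" (is ?contraction)
proof -
  have in_K: "c \<in> V" "ranking_vector V (ppr (indicat_real {c}))" if "c \<in> K" for c
    using that K by (auto intro: ranking_vector_ppr ranking_indicator)
  have y_le: "y w \<le> ppr (indicat_real {c}) w" if "c \<in> K" for c w
    unfolding y using that K by (intro Min_le) auto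
  have y_ge: "z \<le> y w" if "\<And>c. c \<in> K \<Longrightarrow> z \<le> ppr (indicat_real {c}) w" for z w
    unfolding y using that K by (subst Min_ge_iff) auto
  have y_nn: "0 \<le> y w" if "w \<in> V" for w
    using that in_K(2) by (intro y_ge) (auto simp: ranking_vector_def)
  have y_lower: "(1 - a) * (\<pi> w - \<eta>) \<le> y w" if "w \<in> V" for w
    using that in_K(1) by (intro y_ge ppr_lower_bound ranking_indicator) auto
  have y_upper: "y v \<le> (1 + 5 * a) * (\<pi> v + \<eta>)"
  proof -
    obtain c where "c \<in> K" "c \<notin> bad_centers v" using good[OF v] by blast
    then show ?thesis using y_le ppr_upper_bound in_K v by (meson order_trans)
  qed
  let ?Y = "\<Sum>w\<in>V. \<bar>y w\<bar>"
  have Y: "?Y = (\<Sum>w\<in>V. y w)" using y_nn by simp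
  have Y_le: "?Y \<le> 1"
  proof -
    obtain c where c: "c \<in> K" using K by blast
    have "?Y \<le> (\<Sum>w\<in>V. ppr (indicat_real {c}) w)" unfolding Y by (intro sum_mono y_le c)
    then show ?thesis using in_K(2)[OF c] by (simp add: ranking_vector_def)
  qed
  \<comment> \<open>The errors \<eta> summed over \<open>V\<close> amount to at most a, so the
    normaliser loses no more than two factors 1 - a.\<close>
  have Y_ge: "(1 - a)\<^sup>2 \<le> ?Y"
  proof -
    have "real (card V) * \<eta> \<le> real (card V) * (a * h)" using eta by (intro mult_left_mono) auto
    also have "\<dots> \<le> a" using mult_left_mono[OF h(2), of a] a_pos by (simp add: mult_ac)
    finally have "(1 - a) * (1 - a) \<le> (1 - a) * (1 - real (card V) * \<eta>)"
      using a by (intro mult_left_mono) auto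
    also have "\<dots> = (\<Sum>w\<in>V. (1 - a) * (\<pi> w - \<eta>))"
      using ranking_pi by (simp add: sum_subtractf ranking_vector_def flip: sum_distrib_left)
    also have "\<dots> \<le> ?Y" unfolding Y by (intro sum_mono y_lower)
    finally show ?thesis by (simp add: power2_eq_square)
  qed
  have one_minus_a: "0 < 1 - a" using a by simp
  then have Y_pos: "0 < ?Y" using Y_ge zero_less_power[of "1 - a" 2] by linarith
  let ?H = "max (\<pi> v) h"
  have H: "0 < ?H" "h \<le> ?H" using h by auto
  \<comment> \<open>What stretch and contraction reduce to. The right side is 1 + 48a up to
    higher-order terms, and a \<le> 1/50 keeps the quadratic terms below a small multiple of
    a.\<close>
  have poly: "(1 + 5 * a) * (1 + a) \<le> (1 + 50 * a) * (1 - a)\<^sup>2" "1 \<le> (1 + 50 * a) * (1 - a)\<^sup>2"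
  proof -
    have "a * a \<le> 1 / 50 * a" "0 \<le> a * a" "0 \<le> a * (a * a)"
      using a a_pos by (auto intro!: mult_right_mono)
    moreover have "(1 + 50 * a) * (1 - a)\<^sup>2 = 1 + 48 * a - 99 * (a * a) + 50 * (a * (a * a))"
      "(1 + 5 * a) * (1 + a) = 1 + 6 * a + 5 * (a * a)"
      by (simp_all add: power2_eq_square algebra_simps)
    ultimately show "(1 + 5 * a) * (1 + a) \<le> (1 + 50 * a) * (1 - a)\<^sup>2"
      "1 \<le> (1 + 50 * a) * (1 - a)\<^sup>2"
      using a_pos by linarith+
  qed
  have "x v \<le> (1 + 50 * a) * ?H"
  proof -
    have "a * h \<le> a * ?H" using a_pos by (intro mult_left_mono) auto
    moreover have "\<pi> v \<le> ?H" by simp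
    ultimately have "\<pi> v + \<eta> \<le> (1 + a) * ?H" using eta unfolding distrib_right by linarith
    then have "y v \<le> (1 + 5 * a) * ((1 + a) * ?H)"
      using a_pos by (intro order_trans[OF y_upper] mult_left_mono) auto
    also have "\<dots> \<le> (1 + 50 * a) * (1 - a)\<^sup>2 * ?H"
      using mult_right_mono[OF poly(1), of ?H] H by (simp add: mult.assoc)
    also have "\<dots> \<le> (1 + 50 * a) * ?H * ?Y"
      using mult_left_mono[OF Y_ge, of "(1 + 50 * a) * ?H"] a_pos H by (simp add: mult_ac)
    finally show ?thesis unfolding x using Y_pos by (simp add: pos_divide_le_eq)
  qed
  moreover have "h \<le> (1 + 50 * a) * ?H"
    using mult_mono[of 1 "1 + 50 * a" h ?H] a_pos h by simp
  ultimately show ?stretch using H by (simp add: pos_divide_le_eq)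
  have "?H \<le> (1 + 50 * a) * max (x v) h"
  \<comment> \<open>Below the floor the cut-off value is \<open>h\<close> itself; above it, \<eta>
    \<le> a \<pi>(v) turns the additive error into a relative one.\<close>
  proof (cases "\<pi> v \<le> h")
    case True
    then have "?H = h" by simp
    then show ?thesis using mult_mono[of 1 "1 + 50 * a" h "max (x v) h"] a_pos h by simp
  next
    case False
    then have "\<eta> \<le> a * \<pi> v" using eta mult_left_mono[of h "\<pi> v" a] a_pos by linarith
    then have "(1 - a) * ((1 - a) * \<pi> v) \<le> (1 - a) * (\<pi> v - \<eta>)"
      using one_minus_a by (intro mult_left_mono) (auto simp: algebra_simps)
    also have "\<dots> \<le> y v" by (rule y_lower[OF v])
    \<comment> \<open>The normaliser is at most 1, so dividing by it only helps here.\<close>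
    also have "y v \<le> x v"
      unfolding x using Y_pos Y_le y_nn[OF v] by (simp add: pos_le_divide_eq mult_left_le)
    finally have "(1 - a)\<^sup>2 * \<pi> v \<le> max (x v) h" by (simp add: power2_eq_square mult.assoc)
    then have "(1 + 50 * a) * ((1 - a)\<^sup>2 * \<pi> v) \<le> (1 + 50 * a) * max (x v) h"
      using a_pos by (intro mult_left_mono) auto
    moreover have "\<pi> v \<le> (1 + 50 * a) * ((1 - a)\<^sup>2 * \<pi> v)"
      using mult_right_mono[OF poly(2), of "\<pi> v"] pi_nonneg[OF v] by (simp add: mult.assoc)
    ultimately show ?thesis using False by simp
  qed
  then show ?contraction using h by (simp add: pos_divide_le_eq less_max_iff_disj)
qed

end

section \<open>Events about the random sample set\<close>

text \<open>The set is determined by the tuple of samples, which has finitely many values, so the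
  event is a finite union of events fixing every sample.\<close>

lemma sets_Collect_image_count_space:
  assumes V: "finite V" and I: "finite I"
    and X: "\<And>i. i \<in> I \<Longrightarrow> X i \<in> M \<rightarrow>\<^sub>M count_space V"
  shows "{\<omega> \<in> space M. Q ((\<lambda>i. X i \<omega>) ` I)} \<in> sets M"
proof -
  let ?F = "{g \<in> I \<rightarrow>\<^sub>E V. Q (g ` I)}"
  have "{\<omega> \<in> space M. Q ((\<lambda>i. X i \<omega>) ` I)} = (\<Union>g\<in>?F. {\<omega> \<in> space M. \<forall>i\<in>I. X i \<omega> = g i})"
  proof (intro equalityI subsetI)
    fix \<omega> assume \<omega>: "\<omega> \<in> {\<omega> \<in> space M. Q ((\<lambda>i. X i \<omega>) ` I)}"
    then have "restrict (\<lambda>i. X i \<omega>) I \<in> ?F"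
      using measurable_space[OF X] by auto
    with \<omega> show "\<omega> \<in> (\<Union>g\<in>?F. {\<omega> \<in> space M. \<forall>i\<in>I. X i \<omega> = g i})"
      by (intro UN_I[of "restrict (\<lambda>i. X i \<omega>) I"]) auto
  next
    fix \<omega> assume "\<omega> \<in> (\<Union>g\<in>?F. {\<omega> \<in> space M. \<forall>i\<in>I. X i \<omega> = g i})"
    then obtain g where "\<omega> \<in> space M" "Q (g ` I)" "\<forall>i\<in>I. X i \<omega> = g i" by blast
    moreover from this have "(\<lambda>i. X i \<omega>) ` I = g ` I" by (intro image_cong) auto
    ultimately show "\<omega> \<in> {\<omega> \<in> space M. Q ((\<lambda>i. X i \<omega>) ` I)}" by simp
  qed
  also have "\<dots> \<in> sets M"
  proof (intro sets.finite_UN sets.sets_Collect_finite_All I)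
    show "finite ?F" using finite_PiE[OF I, of "\<lambda>_. V"] V by simp
    fix g i assume g: "g \<in> ?F" and i: "i \<in> I"
    then have "g i \<in> V" by auto
    then have "X i -` {g i} \<inter> space M \<in> sets M"
      using X[OF i] by (intro measurable_sets) auto
    also have "X i -` {g i} \<inter> space M = {\<omega> \<in> space M. X i \<omega> = g i}" by auto
    finally show "{\<omega> \<in> space M. X i \<omega> = g i} \<in> sets M" .
  qed
  finally show ?thesis .
qed

text \<open>The image lies in \<open>B\<close> iff each sample does, and independence makes this a
  product.\<close>

lemma (in prob_space) prob_all_samples_in_le:
  assumes V: "finite V" and I: "finite I" "I \<noteq> {}" and B: "B \<subseteq> V"
    and indep: "indep_vars (\<lambda>_. count_space V) X I"
    and p: "\<And>i v. i \<in> I \<Longrightarrow> v \<in> V \<Longrightarrow> prob {\<omega> \<in> space M. X i \<omega> = v} = p v"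
    and q: "(\<Sum>v\<in>B. p v) \<le> q"
  shows "prob {\<omega> \<in> space M. (\<lambda>i. X i \<omega>) ` I \<subseteq> B} \<le> q ^ card I"
proof -
  have X: "X i \<in> M \<rightarrow>\<^sub>M count_space V" if "i \<in> I" for i
    using indep that by (simp add: indep_vars_def2)
  have single: "prob (X i -` B \<inter> space M) \<le> q" if i: "i \<in> I" for i
  proof -
    have "X i -` B \<inter> space M = (\<Union>v\<in>B. X i -` {v} \<inter> space M)" by auto
    also have "prob \<dots> = (\<Sum>v\<in>B. prob (X i -` {v} \<inter> space M))"
      using B V X[OF i]
      by (intro finite_measure_finite_Union) (auto simp: disjoint_family_on_def intro: finite_subset)
    also have "\<dots> = (\<Sum>v\<in>B. p v)"
    proof (intro sum.cong refl)
      fix v assume "v \<in> B"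
      moreover have "X i -` {v} \<inter> space M = {\<omega> \<in> space M. X i \<omega> = v}" by auto
      ultimately show "prob (X i -` {v} \<inter> space M) = p v" using p[OF i] B by auto
    qed
    finally show ?thesis using q by simp
  qed
  have "{\<omega> \<in> space M. (\<lambda>i. X i \<omega>) ` I \<subseteq> B} = (\<Inter>i\<in>I. X i -` B \<inter> space M)"
    using I by auto
  also have "prob \<dots> = (\<Prod>i\<in>I. prob (X i -` B \<inter> space M))"
    using B I by (intro indep_varsD_finite[OF indep]) auto
  also have "\<dots> \<le> (\<Prod>i\<in>I. q)"
    by (intro prod_mono) (simp add: single)
  finally show ?thesis by simp
qed

section \<open>The walk on an ergodic graph\<close>

context sinkless_digraph
begin

lemma row_stochastic_walk_matrix: "row_stochastic (pverts G) (walk_matrix G)"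
proof
  show "finite (pverts G)" by (rule pair_finite_verts)
  show "0 \<le> walk_matrix G u v" for u v by (simp add: walk_matrix_def)
  fix u assume u: "u \<in> pverts G"
  \<comment> \<open>Arcs are ordered pairs, so there are no parallel arcs and the out-degree counts
    out-neighbours.\<close>
  have out: "out_arcs G u = Pair u ` {v \<in> pverts G. (u, v) \<in> parcs G}"
    by (force dest: in_arcsD2)
  then have deg: "out_degree G u = card {v \<in> pverts G. (u, v) \<in> parcs G}"
    by (simp add: out_degree_def card_image inj_on_def)
  obtain w where "(u, w) \<in> parcs G" using sinkless[OF u] by blast
  then have "{v \<in> pverts G. (u, v) \<in> parcs G} \<noteq> {}" by (auto dest: in_arcsD2)
  then have "out_degree G u \<noteq> 0" using deg pair_finite_verts by simp
  then show "(\<Sum>v\<in>pverts G. walk_matrix G u v) = 1"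
    using pair_finite_verts by (simp add: walk_matrix_def sum.If_cases Int_def deg)
qed

sublocale walk: row_stochastic "pverts G" "walk_matrix G"
  by (rule row_stochastic_walk_matrix)

lemma walk_dist_eq_push_iter: "walk_dist G t v = (walk.push ^^ t) (indicat_real {v})"
  by (induction t) (auto simp: walk.push_def)

end

text \<open>Convergence from every start makes the limit the only stationary distribution, so the
  definite description behind \<open>reference_rank\<close> denotes it.\<close>

lemma ergodic_graphs_reference_rank:
  assumes "G \<in> ergodic_graphs"
  shows "stationary (pverts G) (walk_matrix G) (reference_rank G)"
    and "u \<in> pverts G \<Longrightarrow> v \<in> pverts G \<Longrightarrow> (\<lambda>t. walk_dist G t u v) \<longlonglongrightarrow> reference_rank G v"
proof -
  obtain p where G: "sinkless_digraph G" and p: "stationary (pverts G) (walk_matrix G) p"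
    and lim: "\<And>u v. u \<in> pverts G \<Longrightarrow> v \<in> pverts G \<Longrightarrow> (\<lambda>t. walk_dist G t u v) \<longlonglongrightarrow> p v"
    using assms by (auto simp: ergodic_graphs_def)
  interpret sinkless_digraph G by (rule G)
  have "reference_rank G = p"
    unfolding reference_rank_def
    using lim by (intro walk.stationary_distribution_eq_limit[OF p]) (simp add: walk_dist_eq_push_iter)
  with p lim show "stationary (pverts G) (walk_matrix G) (reference_rank G)"
    "u \<in> pverts G \<Longrightarrow> v \<in> pverts G \<Longrightarrow> (\<lambda>t. walk_dist G t u v) \<longlonglongrightarrow> reference_rank G v"
    by auto
qed

text \<open>Convergence from each of finitely many starts yields a common time, so the
  \<open>LEAST\<close> in \<open>mixing_time\<close> is attained.\<close>

lemma tv_dist_mixing_time: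
  assumes "G \<in> ergodic_graphs" "u \<in> pverts G"
  shows "tv_dist (pverts G) (walk_dist G (mixing_time G) u) (reference_rank G) \<le> 1 / 4"
proof -
  interpret sinkless_digraph G using assms by (simp add: ergodic_graphs_def)
  let ?d = "\<lambda>t v. tv_dist (pverts G) (walk_dist G t v) (reference_rank G)"
  have "\<forall>v\<in>pverts G. \<forall>\<^sub>F t in sequentially. ?d t v \<le> 1 / 4"
  proof
    fix v assume v: "v \<in> pverts G"
    have "(\<lambda>t. ?d t v) \<longlonglongrightarrow>
        (\<Sum>w\<in>pverts G. \<bar>reference_rank G w - reference_rank G w\<bar>) / 2"
      unfolding tv_dist_def
      by (intro tendsto_intros ergodic_graphs_reference_rank(2) assms v) auto
    then have "\<forall>\<^sub>F t in sequentially. ?d t v < 1 / 4" by (intro order_tendstoD) auto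
    then show "\<forall>\<^sub>F t in sequentially. ?d t v \<le> 1 / 4" by eventually_elim simp
  qed
  then have "\<forall>\<^sub>F t in sequentially. \<forall>v\<in>pverts G. ?d t v \<le> 1 / 4"
    by (intro eventually_ball_finite pair_finite_verts)
  then obtain t where "\<forall>v\<in>pverts G. ?d t v \<le> 1 / 4"
    by (auto dest: eventually_happens'[OF sequentially_bot])
  from LeastI[of "\<lambda>t. \<forall>v\<in>pverts G. ?d t v \<le> 1 / 4", OF this] assms(2)
  show ?thesis unfolding mixing_time_def by blast
qed

text \<open>At time 0 the walk sits at its start, so distance 1/4 would force stationary mass at
  least 1/2 on each of three or more vertices. Positivity gives L > 0 and hence a > 0.\<close>

lemma mixing_time_pos:
  assumes G: "G \<in> ergodic_graphs" and n: "3 \<le> card (pverts G)"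
  shows "0 < mixing_time G"
proof (rule ccontr)
  interpret sinkless_digraph G using G by (simp add: ergodic_graphs_def)
  let ?V = "pverts G" and ?p = "reference_rank G"
  assume "\<not> 0 < mixing_time G"
  then have "mixing_time G = 0" by simp
  have "1 / 2 \<le> ?p v" if v: "v \<in> ?V" for v
  proof -
    have "\<bar>walk_dist G 0 v v - ?p v\<bar> \<le> (\<Sum>w\<in>?V. \<bar>walk_dist G 0 v w - ?p w\<bar>)"
      by (intro member_le_sum[OF v, of "\<lambda>w. \<bar>walk_dist G 0 v w - ?p w\<bar>"] pair_finite_verts) auto
    then show ?thesis
      using tv_dist_mixing_time[OF G v] \<open>mixing_time G = 0\<close> by (simp add: tv_dist_def)
  qed
  then have "(\<Sum>v\<in>?V. 1 / 2) \<le> (\<Sum>v\<in>?V. ?p v)" by (rule sum_mono)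
  also have "\<dots> = 1"
    using ergodic_graphs_reference_rank(1)[OF G] by (simp add: stationary_def ranking_vector_def)
  finally show False using n by simp
qed

section \<open>Choice of parameters and union bound\<close>

theorem theorem10:
  fixes G :: "'a pair_pre_digraph"
    and T :: "nat \<Rightarrow> real"
    and \<delta> \<epsilon> :: real
    and n k :: nat
    and r :: "'a \<Rightarrow> real"
    and P :: "'w measure"
    and X :: "nat \<Rightarrow> 'w \<Rightarrow> 'a"
  assumes "\<delta> \<ge> 1"
    and "0 < \<epsilon>" and "\<epsilon> < 1"
    and "G \<in> ergodic_graphs"
    and "n = card (pverts G)" and "n \<ge> 3"
    and "T n \<le> 1 / (210 * \<epsilon> * \<delta> * log 2 (real n))"
    and "real (mixing_time G) \<le> T n"
    and "k \<ge> 1"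
    and "ranking_vector (pverts G) r"
    and "prob_space P"
    and "prob_space.indep_vars P (\<lambda>_. count_space (pverts G)) X {1..k}"
    and "\<And>i v. i \<in> {1..k} \<Longrightarrow> v \<in> pverts G \<Longrightarrow>
           measure P {\<omega> \<in> space P. X i \<omega> = v} = pagerank G r \<epsilon> v"
  shows "measure P {\<omega> \<in> space P.
           distortion \<delta> (R_min G ((\<lambda>i. X i \<omega>) ` {1..k}) \<epsilon>) G
             \<le> 1 + 210 * \<epsilon> * \<delta> * T n * log 2 (real n)}
         \<ge> 1 - (1 / 4) ^ k * real n"
proof -
  let ?V = "pverts G"
  define h where "h = real n powr - \<delta>"
  \<comment> \<open>The ceiling makes the power of 1/2 at most \<open>n powr - \<delta>\<close>; the
    extra 2 cancels the factor 4 in \<eta>.\<close>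
  define m where "m = nat \<lceil>\<delta> * log 2 (real n)\<rceil> + 2"
  define \<alpha> where "\<alpha> = 210 * \<epsilon> * \<delta> * T n * log 2 (real n)"
  have log_ge: "1 \<le> log 2 (real n)" using \<open>n \<ge> 3\<close> by simp
  have dlog: "1 \<le> \<delta> * log 2 (real n)"
    using mult_mono[OF \<open>\<delta> \<ge> 1\<close> log_ge] \<open>\<delta> \<ge> 1\<close> by simp
  have "0 < 210 * \<epsilon> * \<delta> * log 2 (real n)"
    using assms(1,2) log_ge by simp
  with assms(7) have alpha_le: "\<alpha> \<le> 1"
    by (simp add: \<alpha>_def pos_le_divide_eq mult_ac)
  have V: "finite ?V" "?V \<noteq> {}"
    using assms(5,6) card_gt_0_iff[of ?V] by auto
  interpret sinkless_digraph G using assms(4) by (simp add: ergodic_graphs_def)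
  interpret mixing_restart_chain ?V "walk_matrix G" \<epsilon> "reference_rank G" "mixing_time G" m
  proof
    show "(\<Sum>v\<in>?V. \<bar>(walk.push ^^ mixing_time G) (indicat_real {u}) v - reference_rank G v\<bar>) \<le> 1 / 2"
      if "u \<in> ?V" for u
      using tv_dist_mixing_time[OF assms(4) that] by (simp add: tv_dist_def walk_dist_eq_push_iter)
  qed (use assms ergodic_graphs_reference_rank(1)[OF assms(4)] mixing_time_pos[OF assms(4)]
      in \<open>auto simp: m_def\<close>)
  interpret prob_space P by fact
  have pagerank_eq: "pagerank G s \<epsilon> = ppr s" for s
    by (simp add: pagerank_def ppr_def)
  \<comment> \<open>Rounding up and adding 2 costs at most 3, hence \<open>m\<close> is at most four
    times \<open>\<delta> * log 2 n\<close>, which is at least 1. So a \<le> 4/210 \<alpha>, and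
    both 50 * 4 \<le> 210 and 4/210 \<le> 1/50 hold.\<close>
  have a_alpha: "50 * a \<le> \<alpha>" "a \<le> 1 / 50"
  proof -
    have "real m \<le> 4 * (\<delta> * log 2 (real n))"
    proof -
      have "real m = real_of_int \<lceil>\<delta> * log 2 (real n)\<rceil> + 2" using dlog by (simp add: m_def)
      then show ?thesis
        using dlog of_int_ceiling_le_add_one[of "\<delta> * log 2 (real n)"] by linarith
    qed
    moreover have "0 \<le> T n" using assms(8) of_nat_0_le_iff order_trans by blast
    ultimately have "real (mixing_time G) * real m \<le> T n * (4 * (\<delta> * log 2 (real n)))"
      using assms(8) by (intro mult_mono) auto
    then have "\<epsilon> * (real (mixing_time G) * real m) \<le> \<epsilon> * (T n * (4 * (\<delta> * log 2 (real n))))"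
      using assms(2) by (intro mult_left_mono) auto
    then have "a \<le> 4 / 210 * \<alpha>"
      using a_le by (simp add: \<alpha>_def mult_ac)
    with a_pos alpha_le show "50 * a \<le> \<alpha>" "a \<le> 1 / 50" by linarith+
  qed
  have eta_h: "\<eta> \<le> a * h"
  proof -
    have "(1 / 2 :: real) ^ m = 1 / 4 * (1 / 2) ^ nat \<lceil>\<delta> * log 2 (real n)\<rceil>"
      by (simp add: m_def)
    then have "\<eta> = a * (1 / 2) ^ nat \<lceil>\<delta> * log 2 (real n)\<rceil>"
      by (simp add: \<eta>_def)
    also have "(1 / 2 :: real) ^ nat \<lceil>\<delta> * log 2 (real n)\<rceil> = 2 powr - real (nat \<lceil>\<delta> * log 2 (real n)\<rceil>)"
      by (simp add: powr_minus powr_realpow power_one_over inverse_eq_divide)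
    also have "\<dots> \<le> 2 powr - (\<delta> * log 2 (real n))"
      by (intro powr_mono) (auto simp: real_nat_ceiling_ge)
    also have "\<dots> = (2 powr log 2 (real n)) powr - \<delta>"
      by (simp add: powr_powr mult.commute)
    also have "\<dots> = h" using \<open>n \<ge> 3\<close> by (simp add: h_def)
    finally show ?thesis using a_pos by simp
  qed
  have h: "0 < h" "real (card ?V) * h \<le> 1"
  proof -
    show "0 < h" using \<open>n \<ge> 3\<close> by (simp add: h_def)
    have "h \<le> real n powr - 1" using assms(1,6) unfolding h_def by (intro powr_mono) auto
    also have "\<dots> = 1 / real n" using assms(6) by (simp add: powr_minus inverse_eq_divide)
    finally show "real (card ?V) * h \<le> 1"
      using assms(6) unfolding assms(5)[symmetric] by (simp add: pos_le_divide_eq mult.commute)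
  qed
  have X: "X i \<in> P \<rightarrow>\<^sub>M count_space ?V" if "i \<in> {1..k}" for i
    using assms(12) that by (simp add: indep_vars_def2)
  let ?K = "\<lambda>\<omega>. (\<lambda>i. X i \<omega>) ` {1..k}"
  let ?good = "{\<omega> \<in> space P. distortion \<delta> (R_min G (?K \<omega>) \<epsilon>) G \<le> 1 + \<alpha>}"
  let ?bad = "\<lambda>v. {\<omega> \<in> space P. ?K \<omega> \<subseteq> bad_centers v}"
  have sets_K: "{\<omega> \<in> space P. Q (?K \<omega>)} \<in> sets P" for Q
    by (intro sets_Collect_image_count_space[OF V(1) _ X]) auto
  \<comment> \<open>Deterministic core: if no vertex has all its sampled centres bad, the distortion
    bound holds. So the good event and the n bad events cover the space.\<close>
  have "\<omega> \<in> ?good \<union> (\<Union>v\<in>?V. ?bad v)" if \<omega>: "\<omega> \<in> space P" for \<omega>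
  proof (cases "\<exists>v\<in>?V. ?K \<omega> \<subseteq> bad_centers v")
    case False
    have K: "finite (?K \<omega>)" "?K \<omega> \<noteq> {}" "?K \<omega> \<subseteq> ?V"
      using \<open>k \<ge> 1\<close> measurable_space[OF X \<omega>] by auto
    have "distortion_at \<delta> (R_min G (?K \<omega>) \<epsilon>) G v \<le> 1 + \<alpha>" if v: "v \<in> ?V" for v
    proof -
      have "max (R_min G (?K \<omega>) \<epsilon> v) h / max (reference_rank G v) h \<le> 1 + 50 * a"
        "max (reference_rank G v) h / max (R_min G (?K \<omega>) \<epsilon> v) h \<le> 1 + 50 * a"
        using False
        by (intro min_ppr_distortion[OF K _ h eta_h a_alpha(2),
              where y = "min_ppr G (?K \<omega>) \<epsilon>"] v;
            auto simp: min_ppr_def R_min_def pagerank_eq)+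
      then show ?thesis
        using a_alpha(1) assms(5) by (simp add: distortion_at_def stretch_def contraction_def h_def)
    qed
    then show ?thesis using V \<omega> by (simp add: distortion_def)
  qed (use \<omega> in blast)
  then have cover: "space P = ?good \<union> (\<Union>v\<in>?V. ?bad v)" by blast
  have "1 = prob (?good \<union> (\<Union>v\<in>?V. ?bad v))" using prob_space cover by simp
  also have "\<dots> \<le> prob ?good + prob (\<Union>v\<in>?V. ?bad v)"
    by (intro measure_Un_le sets_K sets.finite_UN V)
  also have "prob (\<Union>v\<in>?V. ?bad v) \<le> (\<Sum>v\<in>?V. prob (?bad v))"
    by (intro measure_UNION_le V sets_K)
  also have "\<dots> \<le> (\<Sum>v\<in>?V. (1 / 4) ^ k)"
  proof (rule sum_mono)
    fix v assume v: "v \<in> ?V"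
    \<comment> \<open>The exponent counts samples, not distinct centres, so repeated samples do no
      harm.\<close>
    have "prob (?bad v) \<le> (1 / 4) ^ card {1..k}"
    proof (rule prob_all_samples_in_le[OF V(1) _ _ _ assms(12)])
      show "(\<Sum>c\<in>bad_centers v. ppr r c) \<le> 1 / 4"
        using a_alpha(2) by (intro bad_centers_mass assms(10) v) simp
    qed (use assms(9,13) in \<open>auto simp: bad_centers_def pagerank_eq\<close>)
    then show "prob (?bad v) \<le> (1 / 4) ^ k" by simp
  qed
  also have "\<dots> = (1 / 4) ^ k * real n" using assms(5) by simp
  finally show ?thesis by (simp add: \<alpha>_def)
qed

end
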